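(* Let $d\ge 1$ be an integer, $\tau\in(0,+\infty)$, $\eta\in\mathbb{R}^d$, and let $f:[0,+\infty)\times\mathbb{R}^d\times\mathbb{R}^d\to\mathbb{R}^d$ satisfy assumptions (F1)-(F4) listed in the context, with constants $K,H,L$ and exponents $\alpha,\beta_1,\beta_2,\gamma$. Then for any integer $n\ge 0$ there exist $C_0,C_1,\ldots,C_n\ge 0$, depending only on $\tau,\eta,n,d,K,H,L,\alpha,\beta_1,\beta_2,\gamma$ (in particular not on $N$), such that for all positive integers $N\ge 2\lceil\tau\rceil$, with $h=\tau/N$, the following holds: $$\max_{0\le k\le N}\|\phi_0(t_k^0)-y_k^0\|\le C_0\bigl(h^{\alpha\wedge\gamma}+h^{\beta_1}+h^{\beta_2}\bigr),$$ and for $j=1,2,\ldots,n$ $$\max_{0\le k\le N}\|\phi_j(t_k^j)-y_k^j\|\le C_j\sum_{l=1}^j\Bigl(h^{\frac12\gamma^{l-1}}+h^{\gamma^l\cdot(\alpha\wedge\gamma)}+h^{\beta_1\cdot\gamma^l}+h^{\beta_2\cdot\gamma^l}\Bigr),$$ where $\phi_j$ is the solution of the delay differential equation (given in the context) on $[j\tau,(j+1)\tau]$ and $(y_k^j)$ is its Euler approximation (given in the context). In particular, if $\gamma=1$, then for $j=1,2,\ldots,n$ $$\max_{0\le k\le N}\|\phi_j(t_k^j)-y_k^j\|\le jC_j\bigl(h^{1/2}+h^{\alpha}+h^{\beta_1}+h^{\beta_2}\bigr).$$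
   Context: Notation: $x\wedge y=\min\{x,y\}$; $\langle\cdot,\cdot\rangle$ and $\|\cdot\|$ are the Euclidean inner product and norm on $\mathbb{R}^d$. Assumptions on $f:[0,+\infty)\times\mathbb{R}^d\times\mathbb{R}^d\to\mathbb{R}^d$: (F1) $f$ is continuous. (F2) There is $K\in(0,+\infty)$ such that $\|f(t,y,z)\|\le K(1+\|y\|)(1+\|z\|)$ for all $(t,y,z)\in[0,+\infty)\times\mathbb{R}^d\times\mathbb{R}^d$. (F3) There is $H\in\mathbb{R}$ such that $\langle y_1-y_2,f(t,y_1,z)-f(t,y_2,z)\rangle\le H(1+\|z\|)\|y_1-y_2\|^2$ for all $t\ge0$, $z,y_1,y_2\in\mathbb{R}^d$. (F4) There are $L\in(0,+\infty)$ and $\alpha,\beta_1,\beta_2,\gamma\in(0,1]$ such that for all $t_1,t_2\ge 0$, $y_1,y_2,z_1,z_2\in\mathbb{R}^d$ $$\|f(t_1,y_1,z_1)-f(t_2,y_2,z_2)\|\le L\Bigl((1+\|y_1\|+\|y_2\|)(1+\|z_1\|+\|z_2\|)|t_1-t_2|^{\alpha}+(1+\|z_1\|+\|z_2\|)\|y_1-y_2\|^{\beta_1}+(1+\|z_1\|+\|z_2\|)\|y_1-y_2\|^{\beta_2}+(1+\|y_1\|+\|y_2\|)\|z_1-z_2\|^{\gamma}\Bigr).$$ Delay differential equation: $z'(t)=f(t,z(t),z(t-\tau))$ for $t\in[0,(n+1)\tau]$, and $z(t)=\eta$ for $t\in[-\tau,0]$. Under (F1)-(F3) it has a unique solution $z$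 on $[-\tau,(n+1)\tau]$, and $\phi_j$ denotes the restriction of $z$ to $[j\tau,(j+1)\tau]$, $j=0,1,\ldots,n$. Euler scheme: for a positive integer $N$ put $h=\tau/N$, $t_k^j=j\tau+kh$ for $k=0,\ldots,N$, $j=0,\ldots,n$. Set $y_0^0=\eta$, $y_{k+1}^0=y_k^0+h\,f(t_k^0,y_k^0,\eta)$ for $k=0,\ldots,N-1$; and for $j=1,\ldots,n$ set $y_0^j=y_N^{j-1}$, $y_{k+1}^j=y_k^j+h\,f(t_k^j,y_k^j,y_k^{j-1})$ for $k=0,\ldots,N-1$. *)

theory Defs
  imports "HOL-Analysis.Analysis"
begin

text \<open>
  The right-hand side \<open>f : [0,\<infinity>) \<times> \<real>\<^sup>d \<times> \<real>\<^sup>d \<rightarrow> \<real>\<^sup>d\<close> is a curried function on all of \<open>real\<close>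
  in its first argument; only its values at times \<open>t \<ge> 0\<close> are ever constrained or used.
\<close>

type_synonym 'd rhs = "real \<Rightarrow> real ^ 'd \<Rightarrow> real ^ 'd \<Rightarrow> real ^ 'd"

definition F1 :: "('d::finite) rhs \<Rightarrow> bool" where
  "F1 f \<longleftrightarrow> continuous_on ({0..} \<times> UNIV \<times> UNIV) (\<lambda>(t, y, z). f t y z)"

definition F2 :: "real \<Rightarrow> ('d::finite) rhs \<Rightarrow> bool" where
  "F2 K f \<longleftrightarrow> (\<forall>t\<ge>0. \<forall>y z. norm (f t y z) \<le> K * (1 + norm y) * (1 + norm z))"

definition F3 :: "real \<Rightarrow> ('d::finite) rhs \<Rightarrow> bool" where
  "F3 H f \<longleftrightarrow> (\<forall>t\<ge>0. \<forall>z y1 y2.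
     (y1 - y2) \<bullet> (f t y1 z - f t y2 z) \<le> H * (1 + norm z) * (norm (y1 - y2))\<^sup>2)"

definition F4 :: "real \<Rightarrow> real \<Rightarrow> real \<Rightarrow> real \<Rightarrow> real \<Rightarrow> ('d::finite) rhs \<Rightarrow> bool" where
  "F4 L \<alpha> \<beta>1 \<beta>2 \<gamma> f \<longleftrightarrow> (\<forall>t1\<ge>0. \<forall>t2\<ge>0. \<forall>y1 y2 z1 z2.
     norm (f t1 y1 z1 - f t2 y2 z2) \<le> L *
       ((1 + norm y1 + norm y2) * (1 + norm z1 + norm z2) * \<bar>t1 - t2\<bar> powr \<alpha>
        + (1 + norm z1 + norm z2) * norm (y1 - y2) powr \<beta>1
        + (1 + norm z1 + norm z2) * norm (y1 - y2) powr \<beta>2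
        + (1 + norm y1 + norm y2) * norm (z1 - z2) powr \<gamma>))"

text \<open>
  The function \<open>z\<close> solves the delay equation on \<open>[-\<tau>, (n+1)\<tau>]\<close>. The derivative is taken within
  \<open>[0, (n+1)\<tau>]\<close>, so it is one-sided at the two end points (at \<open>0\<close> the left derivative is \<open>0\<close>
  because of the constant history).
\<close>

definition dde_solution :: "('d::finite) rhs \<Rightarrow> real \<Rightarrow> real ^ 'd \<Rightarrow> nat \<Rightarrow> (real \<Rightarrow> real ^ 'd) \<Rightarrow> bool"
  where
  "dde_solution f \<tau> \<eta> n z \<longleftrightarrow>
     (\<forall>t\<in>{-\<tau>..0}. z t = \<eta>) \<and>
     (\<forall>t\<in>{0..(real n + 1) * \<tau>}.
        (z has_vector_derivative f t (z t) (z (t - \<tau>))) (at t within {0..(real n + 1) * \<tau>}))"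

definition segment :: "(real \<Rightarrow> real ^ 'd) \<Rightarrow> real \<Rightarrow> nat \<Rightarrow> real \<Rightarrow> real ^ 'd" where
  "segment z \<tau> j = restrict z {real j * \<tau>..(real j + 1) * \<tau>}"

definition grid :: "real \<Rightarrow> nat \<Rightarrow> nat \<Rightarrow> nat \<Rightarrow> real" where
  "grid \<tau> N j k = real j * \<tau> + real k * (\<tau> / real N)"

text \<open>
  \<open>euler f \<tau> \<eta> N j k\<close> is \<open>y\<^sub>k\<^sup>j\<close>. The recursion also yields values for \<open>k > N\<close>, which are meaningless
  and not used for the values with \<open>k \<le> N\<close>.
\<close>

fun euler :: "('d::finite) rhs \<Rightarrow> real \<Rightarrow> real ^ 'd \<Rightarrow> nat \<Rightarrow> nat \<Rightarrow> nat \<Rightarrow> real ^ 'd" where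
  "euler f \<tau> \<eta> N 0 0 = \<eta>"
| "euler f \<tau> \<eta> N 0 (Suc k) =
     euler f \<tau> \<eta> N 0 k + (\<tau> / real N) *\<^sub>R f (grid \<tau> N 0 k) (euler f \<tau> \<eta> N 0 k) \<eta>"
| "euler f \<tau> \<eta> N (Suc j) 0 = euler f \<tau> \<eta> N j N"
| "euler f \<tau> \<eta> N (Suc j) (Suc k) =
     euler f \<tau> \<eta> N (Suc j) k
     + (\<tau> / real N) *\<^sub>R f (grid \<tau> N (Suc j) k) (euler f \<tau> \<eta> N (Suc j) k) (euler f \<tau> \<eta> N j k)"

definition max_error :: "('d::finite) rhs \<Rightarrow> real \<Rightarrow> real ^ 'd \<Rightarrow> (real \<Rightarrow> real ^ 'd) \<Rightarrow> nat \<Rightarrow> nat \<Rightarrow> real"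
  where
  "max_error f \<tau> \<eta> z N j =
     (MAX k\<in>{0..N}. norm (segment z \<tau> j (grid \<tau> N j k) - euler f \<tau> \<eta> N j k))"

end

theory Submission
  imports Defs
begin

text \<open>
  By (F2) and Gronwall, the solution and the Euler values stay in a ball whose radius \<open>M\<close> depends
  only on the data, so on that ball the solution is Lipschitz and the factors in (F3) and (F4)
  are constants. Let \<open>u\<close> be the linear interpolant of one Euler step. By (F3) and (F4),
  \<open>\<parallel>z - u\<parallel>\<^sup>2\<close> has derivative at most \<open>A \<parallel>z - u\<parallel>\<^sup>2 + R\<^sup>2\<close>, where \<open>R\<close> is of order
  \<open>h powr \<alpha> + h powr \<beta>1 + h powr \<beta>2 + \<delta> powr \<gamma>\<close> and \<open>\<delta>\<close> bounds the error in the delayed argument.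
  This \<open>\<delta>\<close> vanishes on the first segment and is at most \<open>Q h\<close> plus the error of the previous
  segment on the later ones, so each segment multiplies the exponents of the rate by \<open>\<gamma>\<close>. The error
  on segment \<open>j\<close> is therefore already bounded by the summand \<open>l = j\<close> of the claimed sum, without its
  term \<open>h powr (1/2 * \<gamma> ^ (j - 1))\<close>.
\<close>

section \<open>Gronwall inequality and elementary estimates for real powers\<close>

text \<open>With the integrating factor, \<open>g\<close> has derivative at most
  \<open>exp (- (A * (s - a))) * B - B\<close>, which is nonpositive, so
  \<open>g t \<le> g a\<close>. Keeping \<open>B * (t - a)\<close> inside the bracket avoids a
  division by \<open>A\<close>, so \<open>A = 0\<close> is covered.\<close>

lemma gronwall_differential:
  fixes \<phi> \<phi>' :: "real \<Rightarrow> real"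
  assumes der: "\<And>s. s \<in> {a..b} \<Longrightarrow> (\<phi> has_real_derivative \<phi>' s) (at s within {a..b})"
    and le: "\<And>s. s \<in> {a..b} \<Longrightarrow> \<phi>' s \<le> A * \<phi> s + B"
    and "A \<ge> 0" "B \<ge> 0" and t: "t \<in> {a..b}"
  shows "\<phi> t \<le> exp (A * (t - a)) * (\<phi> a + B * (t - a))"
proof -
  define g where "g s = exp (- (A * (s - a))) * \<phi> s - B * (s - a)" for s
  define g' where "g' s = exp (- (A * (s - a))) * (\<phi>' s - A * \<phi> s) - B" for s
  have g_der: "(g has_real_derivative g' s) (at s within {a..b})" if "s \<in> {a..b}" for s
  proof -
    have exp_der: "((\<lambda>s. exp (- (A * (s - a)))) has_real_derivative - A * exp (- (A * (s - a))))
        (at s within {a..b})"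
      by (auto intro!: derivative_eq_intros)
    have lin_der: "((\<lambda>s. B * (s - a)) has_real_derivative B) (at s within {a..b})"
      by (auto intro!: derivative_eq_intros)
    have "(g has_real_derivative
        exp (- (A * (s - a))) * \<phi>' s + - A * exp (- (A * (s - a))) * \<phi> s - B) (at s within {a..b})"
      unfolding g_def by (intro DERIV_diff DERIV_mult' exp_der lin_der der that)
    then show ?thesis
      by (rule DERIV_cong) (simp add: g'_def algebra_simps)
  qed
  have "continuous_on {a..b} g"
    by (rule DERIV_continuous_on[OF g_der])
  then have cont: "continuous_on {a..t} g"
    using t by (auto elim: continuous_on_subset)
  have g'_le: "g' s \<le> 0" if "s \<in> {a..b}" for s
  proof -
    have "exp (- (A * (s - a))) * (\<phi>' s - A * \<phi> s) \<le> exp (- (A * (s - a))) * B"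
      using le[OF that] by (intro mult_left_mono) auto
    also have "\<dots> \<le> 1 * B"
      using that \<open>A \<ge> 0\<close> \<open>B \<ge> 0\<close> by (intro mult_right_mono) auto
    finally show ?thesis by (simp add: g'_def)
  qed
  have "g t \<le> g a"
  proof (rule DERIV_nonpos_imp_decreasing_open[OF _ _ cont])
    show "a \<le> t" using t by simp
    fix s assume s: "a < s" "s < t"
    then have "at s within {a..b} = at s"
      using t by (intro at_within_interior) auto
    with g_der[of s] g'_le[of s] s t show "\<exists>y. (g has_real_derivative y) (at s) \<and> y \<le> 0"
      by auto
  qed
  then have "exp (- (A * (t - a))) * \<phi> t \<le> \<phi> a + B * (t - a)"
    by (simp add: g_def)
  then have "exp (A * (t - a)) * (exp (- (A * (t - a))) * \<phi> t) \<le> exp (A * (t - a)) * (\<phi> a + B * (t - a))"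
    by (intro mult_left_mono) auto
  then show ?thesis
    by (simp add: mult.assoc[symmetric] exp_add[symmetric])
qed

lemma has_real_derivative_norm_squared:
  fixes u :: "real \<Rightarrow> 'a::real_inner"
  assumes "(u has_vector_derivative u') (at t within S)"
  shows "((\<lambda>s. (norm (u s))\<^sup>2) has_real_derivative 2 * (u t \<bullet> u')) (at t within S)"
proof -
  have d: "(u has_derivative (\<lambda>x. x *\<^sub>R u')) (at t within S)"
    using assms by (simp add: has_vector_derivative_def)
  show ?thesis
    unfolding power2_norm_eq_inner has_field_derivative_def
    by (rule has_derivative_eq_rhs[OF has_derivative_inner[OF d d]])
      (auto simp: inner_commute algebra_simps)
qed

text \<open>Write \<open>x powr p\<close> as \<open>x * x powr (p - 1)\<close>; the second factor is
  nonincreasing in \<open>x\<close> because \<open>p \<le> 1\<close>, so replacing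
  \<open>a + b\<close> by \<open>a\<close> or by \<open>b\<close> there only increases it.\<close>

lemma powr_add_le:
  fixes a b p :: real
  assumes "a \<ge> 0" "b \<ge> 0" "0 < p" "p \<le> 1"
  shows "(a + b) powr p \<le> a powr p + b powr p"
proof (cases "a = 0 \<or> b = 0")
  case True
  then show ?thesis using assms by auto
next
  case False
  then have pos: "a > 0" "b > 0" using assms by auto
  have split: "x powr p = x * x powr (p - 1)" if "x > 0" for x :: real
    using that by (simp add: powr_mult_base)
  have "(a + b) powr p = a * (a + b) powr (p - 1) + b * (a + b) powr (p - 1)"
    using pos split[of "a + b"] by (simp add: distrib_right)
  also have "\<dots> \<le> a * a powr (p - 1) + b * b powr (p - 1)"
    using pos assms(4) by (intro add_mono mult_left_mono powr_mono2') simp_all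
  finally show ?thesis using pos split by simp
qed

lemma powr_le_one_plus:
  fixes x p :: real
  assumes "x \<ge> 0" "0 < p" "p \<le> 1"
  shows "x powr p \<le> 1 + x"
proof -
  have "x powr p \<le> (1 + x) powr p"
    using assms by (intro powr_mono2) auto
  also have "\<dots> \<le> (1 + x) powr 1"
    using assms by (intro powr_mono) auto
  finally show ?thesis using assms by simp
qed

text \<open>The factor \<open>1 + c\<close> stands in for \<open>c powr p\<close>, so that the same
  constant serves every exponent.\<close>

lemma powr_mult_le:
  fixes c x p :: real
  assumes "c \<ge> 0" "x \<ge> 0" "0 < p" "p \<le> 1"
  shows "(c * x) powr p \<le> (1 + c) * x powr p"
  using powr_le_one_plus[of c p] assms by (simp add: powr_mult mult_right_mono)

section \<open>Growth and Hoelder conditions on a ball\<close>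

lemma F2D: "F2 K f \<Longrightarrow> t \<ge> 0 \<Longrightarrow> norm (f t y z) \<le> K * (1 + norm y) * (1 + norm z)"
  by (simp add: F2_def)

lemma F2_bounded:
  assumes "F2 K f" "K > 0" "t \<ge> 0" "norm y \<le> M" "norm z \<le> M"
  shows "norm (f t y z) \<le> K * (1 + M)\<^sup>2"
proof -
  have "M \<ge> 0"
    using assms(4) norm_ge_zero[of y] by linarith
  have "norm (f t y z) \<le> K * (1 + norm y) * (1 + norm z)"
    using assms by (simp add: F2D)
  also have "\<dots> \<le> K * (1 + M) * (1 + M)"
    using assms(2,4,5) \<open>M \<ge> 0\<close> by (intro mult_mono mult_nonneg_nonneg add_nonneg_nonneg) simp_all
  finally show ?thesis by (simp add: power2_eq_square mult.assoc)
qed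

text \<open>On bounded arguments all weights in (F4) are at most \<open>P\<close>, and
  \<open>P\<^sup>2\<close> serves as common factor of the four powers. The roles are asymmetric:
  \<open>y1\<close> is a point of the interpolant, which may leave the ball of radius
  \<open>M\<close> by \<open>Q\<close>, while \<open>y2\<close> is the Euler value where the step
  starts.\<close>

lemma F4_consistency:
  assumes F4: "F4 L \<alpha> \<beta>1 \<beta>2 \<gamma> f" and "L > 0"
    and exps: "\<alpha> \<in> {0<..1}" "\<beta>1 \<in> {0<..1}" "\<beta>2 \<in> {0<..1}" "\<gamma> \<in> {0<..1}"
    and t: "t1 \<ge> 0" "t2 \<ge> 0" "\<bar>t1 - t2\<bar> \<le> h"
    and y: "norm (y1 - y2) \<le> Q * h" "norm y1 \<le> M + Q" "norm y2 \<le> M"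
    and z: "norm (z1 - z2) \<le> \<delta>" "norm z1 \<le> M" "norm z2 \<le> M"
    and "Q \<ge> 0"
  shows "norm (f t1 y1 z1 - f t2 y2 z2)
    \<le> L * (1 + 2 * M + Q)\<^sup>2 * (h powr \<alpha> + h powr \<beta>1 + h powr \<beta>2 + \<delta> powr \<gamma>)"
proof -
  define P where "P = 1 + 2 * M + Q"
  have M: "M \<ge> 0" using y(3) norm_ge_zero[of y2] by linarith
  have h: "h \<ge> 0" using t by linarith
  have \<delta>: "\<delta> \<ge> 0" using z(1) norm_ge_zero[of "z1 - z2"] by linarith
  have P: "P \<ge> 1" using M \<open>Q \<ge> 0\<close> by (simp add: P_def)
  have P2: "P \<le> P\<^sup>2" using P by (simp add: power2_eq_square)
  have yy: "1 + norm y1 + norm y2 \<le> P" using y by (simp add: P_def)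
  have zz: "1 + norm z1 + norm z2 \<le> P" using z \<open>Q \<ge> 0\<close> by (simp add: P_def)
  have \<beta>: "(1 + norm z1 + norm z2) * norm (y1 - y2) powr \<beta> \<le> P\<^sup>2 * h powr \<beta>"
    if "\<beta> \<in> {0<..1}" for \<beta>
  proof -
    have "norm (y1 - y2) powr \<beta> \<le> (Q * h) powr \<beta>"
      using that y by (intro powr_mono2) auto
    also have "\<dots> \<le> (1 + Q) * h powr \<beta>"
      using that \<open>Q \<ge> 0\<close> h by (intro powr_mult_le) auto
    also have "\<dots> \<le> P * h powr \<beta>"
      using M by (intro mult_right_mono) (auto simp: P_def)
    finally have "(1 + norm z1 + norm z2) * norm (y1 - y2) powr \<beta> \<le> P * (P * h powr \<beta>)"
      using zz P by (intro mult_mono) auto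
    then show ?thesis by (simp add: power2_eq_square mult.assoc)
  qed
  have \<alpha>: "(1 + norm y1 + norm y2) * (1 + norm z1 + norm z2) * \<bar>t1 - t2\<bar> powr \<alpha> \<le> P\<^sup>2 * h powr \<alpha>"
    unfolding power2_eq_square using P exps(1)
    by (intro mult_mono yy zz powr_mono2 t(3)) simp_all
  have \<gamma>: "(1 + norm y1 + norm y2) * norm (z1 - z2) powr \<gamma> \<le> P\<^sup>2 * \<delta> powr \<gamma>"
    using exps(4) by (intro mult_mono order_trans[OF yy P2] powr_mono2 z(1)) simp_all
  have "norm (f t1 y1 z1 - f t2 y2 z2) \<le> L * ((1 + norm y1 + norm y2) * (1 + norm z1 + norm z2) * \<bar>t1 - t2\<bar> powr \<alpha>
      + (1 + norm z1 + norm z2) * norm (y1 - y2) powr \<beta>1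
      + (1 + norm z1 + norm z2) * norm (y1 - y2) powr \<beta>2
      + (1 + norm y1 + norm y2) * norm (z1 - z2) powr \<gamma>)"
    using F4[unfolded F4_def] t(1,2) by blast
  also have "\<dots> \<le> L * (P\<^sup>2 * h powr \<alpha> + P\<^sup>2 * h powr \<beta>1 + P\<^sup>2 * h powr \<beta>2 + P\<^sup>2 * \<delta> powr \<gamma>)"
    using \<open>L > 0\<close> by (intro mult_left_mono add_mono \<alpha> \<beta> exps(2,3) \<gamma>) simp
  also have "\<dots> = L * P\<^sup>2 * (h powr \<alpha> + h powr \<beta>1 + h powr \<beta>2 + \<delta> powr \<gamma>)"
    by (simp only: distrib_left mult.assoc)
  finally show ?thesis by (simp only: P_def)
qed

section \<open>Discrete Gronwall inequality and the error of one Euler step\<close>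

text \<open>Each new \<open>b\<close> is enlarged to \<open>exp (real k * a) * b\<close>, so the
  exponential factors out at every step. The hypothesis has the shape that the differential Gronwall
  inequality yields over one step.\<close>

lemma discrete_gronwall_exp:
  fixes e :: "nat \<Rightarrow> real"
  assumes step: "\<And>k. k < N \<Longrightarrow> e (Suc k) \<le> exp a * (e k + b)"
    and "a \<ge> 0" "b \<ge> 0" "k \<le> N"
  shows "e k \<le> exp (real k * a) * (e 0 + real k * b)"
  using \<open>k \<le> N\<close>
proof (induction k)
  case (Suc k)
  have b_le: "b \<le> exp (real k * a) * b"
    using \<open>a \<ge> 0\<close> \<open>b \<ge> 0\<close> by (simp add: mult_le_cancel_right1)
  have "e (Suc k) \<le> exp a * (e k + b)"
    using step Suc.prems by simp
  also have "\<dots> \<le> exp a * (exp (real k * a) * (e 0 + real k * b) + exp (real k * a) * b)"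
    using Suc b_le by (intro mult_left_mono add_mono) auto
  also have "\<dots> = exp (real (Suc k) * a) * (e 0 + real (Suc k) * b)"
    by (simp add: exp_add algebra_simps)
  finally show ?case .
qed simp

text \<open>
  The one-sided Lipschitz condition (F3) is applied to \<open>z - u\<close> for the linear interpolant \<open>u\<close> of
  the Euler step, so that the consistency error of \<open>u\<close> enters only through a term that does not
  involve \<open>z - u\<close>.
\<close>

lemma euler_step_error:
  assumes F2: "F2 K f" and "K > 0" and F3: "F3 H f" and F4: "F4 L \<alpha> \<beta>1 \<beta>2 \<gamma> f" and "L > 0"
    and exps: "\<alpha> \<in> {0<..1}" "\<beta>1 \<in> {0<..1}" "\<beta>2 \<in> {0<..1}" "\<gamma> \<in> {0<..1}"
    and h: "0 \<le> h" "h \<le> 1" and "a \<ge> 0"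
    and z_der: "\<And>t. t \<in> {a..a+h} \<Longrightarrow> (z has_vector_derivative f t (z t) (v t)) (at t within {a..a+h})"
    and v: "\<And>t. t \<in> {a..a+h} \<Longrightarrow> norm (v t) \<le> M"
    and vw: "\<And>t. t \<in> {a..a+h} \<Longrightarrow> norm (v t - w) \<le> \<delta>"
    and y: "norm y \<le> M" and w: "norm w \<le> M"
  defines "Q \<equiv> K * (1 + M)\<^sup>2"
  defines "A \<equiv> 2 * \<bar>H\<bar> * (1 + M) + 1"
    and "R \<equiv> L * (1 + 2 * M + Q)\<^sup>2 * (h powr \<alpha> + h powr \<beta>1 + h powr \<beta>2 + \<delta> powr \<gamma>)"
  shows "(norm (z (a + h) - (y + h *\<^sub>R f a y w)))\<^sup>2 \<le> exp (A * h) * ((norm (z a - y))\<^sup>2 + R\<^sup>2 * h)"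
proof -
  have M: "M \<ge> 0" using y norm_ge_zero[of y] by linarith
  have Q: "Q \<ge> 0" using \<open>K > 0\<close> by (simp add: Q_def)
  have A: "A \<ge> 0" using M by (simp add: A_def)
  define u where "u t = y + (t - a) *\<^sub>R f a y w" for t
  have fQ: "norm (f a y w) \<le> Q"
    unfolding Q_def using F2 \<open>K > 0\<close> \<open>a \<ge> 0\<close> y w by (rule F2_bounded)
  have u_der: "(u has_vector_derivative f a y w) (at t within S)" for t S
    unfolding u_def by (auto intro!: derivative_eq_intros)
  let ?\<phi> = "\<lambda>t. (norm (z t - u t))\<^sup>2"
  let ?\<phi>' = "\<lambda>t. 2 * ((z t - u t) \<bullet> (f t (z t) (v t) - f a y w))"
  have "?\<phi> (a + h) \<le> exp (A * (a + h - a)) * (?\<phi> a + R\<^sup>2 * (a + h - a))"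
  proof (rule gronwall_differential)
    fix t assume t: "t \<in> {a..a+h}"
    show "(?\<phi> has_real_derivative ?\<phi>' t) (at t within {a..a+h})"
      by (intro has_real_derivative_norm_squared has_vector_derivative_diff z_der t u_der)
    have "norm (u t - y) = (t - a) * norm (f a y w)"
      using t by (simp add: u_def)
    also have "\<dots> \<le> h * Q"
      using t fQ h by (intro mult_mono) auto
    finally have uy: "norm (u t - y) \<le> Q * h"
      by (simp add: mult.commute)
    \<comment> \<open>Here \<open>h \<le> 1\<close> keeps the interpolant within the radius
      \<open>M + Q\<close> granted by \<open>F4_consistency\<close>.\<close>
    have "Q * h \<le> Q * 1"
      using h Q by (intro mult_left_mono) auto
    then have u_le: "norm (u t) \<le> M + Q"
      using uy y norm_triangle_sub[of "u t" y] by simp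
    have R: "norm (f t (u t) (v t) - f a y w) \<le> R"
      unfolding R_def
    proof (rule F4_consistency[OF F4 \<open>L > 0\<close> exps _ \<open>a \<ge> 0\<close> _ uy u_le y vw[OF t] v[OF t] w Q])
      show "t \<ge> 0" "\<bar>t - a\<bar> \<le> h" using t \<open>a \<ge> 0\<close> by auto
    qed
    \<comment> \<open>Both terms share the time and the delayed value, as (F3) demands; the change
      of these two, and of \<open>u t\<close> to \<open>y\<close>, is left to \<open>R\<close>. The
      absolute value covers negative \<open>H\<close>.\<close>
    have "(z t - u t) \<bullet> (f t (z t) (v t) - f t (u t) (v t)) \<le> H * (1 + norm (v t)) * ?\<phi> t"
      using F3 t \<open>a \<ge> 0\<close> by (simp add: F3_def)
    also have "\<dots> \<le> \<bar>H\<bar> * (1 + M) * ?\<phi> t"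
      using v[OF t] by (intro mult_right_mono mult_mono) auto
    finally have 1: "(z t - u t) \<bullet> (f t (z t) (v t) - f t (u t) (v t)) \<le> \<bar>H\<bar> * (1 + M) * ?\<phi> t" .
    have "(z t - u t) \<bullet> (f t (u t) (v t) - f a y w) \<le> norm (z t - u t) * norm (f t (u t) (v t) - f a y w)"
      by (rule norm_cauchy_schwarz)
    also have "\<dots> \<le> norm (z t - u t) * R"
      using R by (intro mult_left_mono) auto
    \<comment> \<open>Young's inequality splits the product into squares; it accounts for the
      summand 1 in \<open>A\<close> and for the square of \<open>R\<close>.\<close>
    finally have 2: "2 * ((z t - u t) \<bullet> (f t (u t) (v t) - f a y w)) \<le> ?\<phi> t + R\<^sup>2"
      using sum_squares_bound[of "norm (z t - u t)" R] by simp
    have "?\<phi>' t = 2 * ((z t - u t) \<bullet> (f t (z t) (v t) - f t (u t) (v t)))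
        + 2 * ((z t - u t) \<bullet> (f t (u t) (v t) - f a y w))"
      by (simp add: algebra_simps)
    also have "\<dots> \<le> 2 * (\<bar>H\<bar> * (1 + M) * ?\<phi> t) + (?\<phi> t + R\<^sup>2)"
      using 1 2 by linarith
    also have "\<dots> = A * ?\<phi> t + R\<^sup>2"
      by (simp add: A_def algebra_simps)
    finally show "?\<phi>' t \<le> A * ?\<phi> t + R\<^sup>2" .
  qed (use A h in auto)
  then show ?thesis by (simp add: u_def)
qed


section \<open>Grid points, and a priori bound for the solution\<close>

lemma grid_nonneg: "\<tau> > 0 \<Longrightarrow> grid \<tau> N j k \<ge> 0"
  by (simp add: grid_def)

lemma grid_Suc_0: "N > 0 \<Longrightarrow> grid \<tau> N (Suc j) 0 = grid \<tau> N j N"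
  by (simp add: grid_def algebra_simps)

lemma grid_Suc: "grid \<tau> N j (Suc k) = grid \<tau> N j k + \<tau> / real N"
  by (simp add: grid_def algebra_simps add_divide_distrib)

lemma grid_shift: "grid \<tau> N (Suc j) k - \<tau> = grid \<tau> N j k"
  by (simp add: grid_def algebra_simps)

lemma grid_mem_segment:
  assumes "\<tau> > 0" "k \<le> N" "N > 0"
  shows "grid \<tau> N j k \<in> {real j * \<tau>..(real j + 1) * \<tau>}"
proof -
  have "real k * (\<tau> / real N) \<le> real N * (\<tau> / real N)"
    using assms by (intro mult_right_mono) auto
  then show ?thesis using assms by (simp add: grid_def distrib_right)
qed

lemma segment_mono:
  assumes "\<tau> > 0" "j \<le> n"
  shows "{real j * \<tau>..(real j + 1) * \<tau>} \<subseteq> {0..(real n + 1) * \<tau>}"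
proof -
  have "(real j + 1) * \<tau> \<le> (real n + 1) * \<tau>"
    using assms by (intro mult_right_mono) auto
  then show ?thesis using assms by (auto intro: order_trans[OF mult_nonneg_nonneg])
qed

lemma dde_solution_history: "dde_solution f \<tau> \<eta> n z \<Longrightarrow> t \<in> {-\<tau>..0} \<Longrightarrow> z t = \<eta>"
  unfolding dde_solution_def by blast

lemma dde_solution_derivative:
  assumes "dde_solution f \<tau> \<eta> n z" "{a..b} \<subseteq> {0..(real n + 1) * \<tau>}" "t \<in> {a..b}"
  shows "(z has_vector_derivative f t (z t) (z (t - \<tau>))) (at t within {a..b})"
  using assms unfolding dde_solution_def by (meson has_vector_derivative_within_subset subsetD)

text \<open>Energy estimate: on this segment the delayed argument lies where \<open>M\<close> is
  already a bound, so (F2) becomes linear growth in \<open>z s\<close> alone. The inner product is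
  then at most \<open>K * (1 + M)\<close> times the sum of \<open>norm (z s)\<close> and its square,
  and bounding that sum by twice the square plus 2 gives the 4 in \<open>A\<close>.\<close>

lemma solution_bound_step:
  assumes sol: "dde_solution f \<tau> \<eta> n z" and F2: "F2 K f" and "K > 0" "\<tau> > 0" and j: "j \<le> n"
    and M: "\<And>t. t \<in> {-\<tau>..real j * \<tau>} \<Longrightarrow> norm (z t) \<le> M"
    and t: "t \<in> {real j * \<tau>..(real j + 1) * \<tau>}"
  defines "A \<equiv> 4 * K * (1 + M)"
  shows "(norm (z t))\<^sup>2 \<le> exp (A * \<tau>) * (M\<^sup>2 + A * \<tau>)"
proof -
  let ?I = "{real j * \<tau>..(real j + 1) * \<tau>}"
  have jt: "norm (z (real j * \<tau>)) \<le> M"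
    using M[of "real j * \<tau>"] \<open>\<tau> > 0\<close> by (simp add: order_trans[of "-\<tau>" 0])
  then have M0: "M \<ge> 0" using norm_ge_zero order_trans by blast
  then have A: "A \<ge> 0" using \<open>K > 0\<close> by (simp add: A_def)
  let ?\<phi> = "\<lambda>s. (norm (z s))\<^sup>2"
  let ?\<phi>' = "\<lambda>s. 2 * (z s \<bullet> f s (z s) (z (s - \<tau>)))"
  have "?\<phi> t \<le> exp (A * (t - real j * \<tau>)) * (?\<phi> (real j * \<tau>) + A * (t - real j * \<tau>))"
  proof (rule gronwall_differential[where b = "(real j + 1) * \<tau>"])
    fix s assume s: "s \<in> ?I"
    show "(?\<phi> has_real_derivative ?\<phi>' s) (at s within ?I)"
      by (intro has_real_derivative_norm_squared dde_solution_derivative[OF sol] segment_mono \<open>\<tau> > 0\<close> j s)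
    have s0: "s \<ge> 0" using s segment_mono[OF \<open>\<tau> > 0\<close> j] by auto
    have v: "norm (z (s - \<tau>)) \<le> M"
      using s s0 by (intro M) (auto simp: algebra_simps)
    let ?y = "norm (z s)"
    have "z s \<bullet> f s (z s) (z (s - \<tau>)) \<le> ?y * norm (f s (z s) (z (s - \<tau>)))"
      by (rule norm_cauchy_schwarz)
    also have "\<dots> \<le> ?y * (K * (1 + ?y) * (1 + norm (z (s - \<tau>))))"
      using F2D[OF F2 s0] by (intro mult_left_mono) auto
    also have "\<dots> \<le> ?y * (K * (1 + ?y) * (1 + M))"
      using v \<open>K > 0\<close> by (intro mult_left_mono) auto
    also have "\<dots> = K * (1 + M) * (?y + ?y\<^sup>2)"
      by (simp add: power2_eq_square algebra_simps)
    also have "\<dots> \<le> K * (1 + M) * (2 * ?y\<^sup>2 + 2)"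
    proof (rule mult_left_mono)
      show "?y + ?y\<^sup>2 \<le> 2 * ?y\<^sup>2 + 2"
        using sum_squares_bound[of "norm (z s)" 1] zero_le_power2[of "norm (z s)"]
        unfolding power_one mult_1_right by linarith
    qed (use M0 \<open>K > 0\<close> in auto)
    finally show "?\<phi>' s \<le> A * ?\<phi> s + A"
      by (simp add: A_def algebra_simps)
  qed (use A t in auto)
  also have "\<dots> \<le> exp (A * \<tau>) * (M\<^sup>2 + A * \<tau>)"
  proof -
    have "t - real j * \<tau> \<le> \<tau>"
      using t by (simp add: algebra_simps)
    then have "A * (t - real j * \<tau>) \<le> A * \<tau>"
      using A by (rule mult_left_mono)
    moreover have "?\<phi> (real j * \<tau>) \<le> M\<^sup>2"
      using jt by (rule power_mono) simp
    moreover have "0 \<le> A * (t - real j * \<tau>)"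
      using A t by simp
    ultimately show ?thesis
      by (intro mult_mono[OF _ add_mono]) simp_all
  qed
  finally show ?thesis .
qed

text \<open>Method of steps: each segment is bounded through the preceding ones. \<open>M\<close> is
  chosen before \<open>f\<close> and \<open>z\<close>, which keeps the final constants uniform over
  all admissible right-hand sides.\<close>

lemma solution_bounded:
  fixes \<eta> :: "real ^ 'd"
  assumes "K > 0" "\<tau> > 0" and "j \<le> Suc n"
  shows "\<exists>M\<ge>0. \<forall>(f :: 'd rhs) z. F2 K f \<and> dde_solution f \<tau> \<eta> n z \<longrightarrow>
    (\<forall>t\<in>{-\<tau>..real j * \<tau>}. norm (z t) \<le> M)"
  using \<open>j \<le> Suc n\<close>
proof (induction j)
  case 0
  then show ?case by (intro exI[of _ "norm \<eta>"]) (auto simp: dde_solution_def)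
next
  case (Suc j)
  then obtain M where M: "M \<ge> 0"
    "\<And>(f :: 'd rhs) z t. F2 K f \<Longrightarrow> dde_solution f \<tau> \<eta> n z \<Longrightarrow> t \<in> {-\<tau>..real j * \<tau>} \<Longrightarrow> norm (z t) \<le> M"
    by auto
  define A where "A = 4 * K * (1 + M)"
  define M' where "M' = max M (sqrt (exp (A * \<tau>) * (M\<^sup>2 + A * \<tau>)))"
  have "norm (z t) \<le> M'"
    if "F2 K f" "dde_solution f \<tau> \<eta> n z" "t \<in> {-\<tau>..real (Suc j) * \<tau>}" for f :: "'d rhs" and z t
  proof (cases "t \<le> real j * \<tau>")
    case True
    then show ?thesis using M(2)[OF that(1,2), of t] that(3) by (simp add: M'_def)
  next
    case False
    then have "t \<in> {real j * \<tau>..(real j + 1) * \<tau>}"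
      using that(3) by (simp add: add.commute)
    then have "(norm (z t))\<^sup>2 \<le> exp (A * \<tau>) * (M\<^sup>2 + A * \<tau>)"
      unfolding A_def using Suc.prems
      by (intro solution_bound_step[OF that(2,1) assms(1,2) _ M(2)[OF that(1,2)]]) simp_all
    then have "norm (z t) \<le> sqrt (exp (A * \<tau>) * (M\<^sup>2 + A * \<tau>))"
      by (rule real_le_rsqrt)
    then show ?thesis by (simp add: M'_def)
  qed
  moreover have "M' \<ge> 0" using M(1) by (simp add: M'_def)
  ultimately show ?case by blast
qed

section \<open>A priori bound for the Euler values\<close>

text \<open>Adding 1 to the norm turns the affine growth in (F2) into a pure factor
  \<open>1 + a\<close> per step, so the discrete Gronwall inequality applies with
  \<open>b = 0\<close>. The bound sees the step size only through \<open>real N * h\<close>.\<close>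

lemma euler_bound_step:
  fixes y w :: "nat \<Rightarrow> real ^ 'd"
  assumes step: "\<And>k. k < N \<Longrightarrow> y (Suc k) = y k + h *\<^sub>R f (t k) (y k) (w k)"
    and F2: "F2 K f" and "K > 0" "h \<ge> 0" and t: "\<And>k. t k \<ge> 0"
    and w: "\<And>k. k < N \<Longrightarrow> norm (w k) \<le> M" and "M \<ge> 0" and "k \<le> N"
  shows "1 + norm (y k) \<le> exp (K * (1 + M) * (real N * h)) * (1 + norm (y 0))"
proof -
  define a where "a = h * (K * (1 + M))"
  have a: "a \<ge> 0" using assms by (simp add: a_def)
  have "1 + norm (y k) \<le> exp (real k * a) * ((1 + norm (y 0)) + real k * 0)"
  proof (rule discrete_gronwall_exp[where N = N])
    fix k assume k: "k < N"
    have "norm (f (t k) (y k) (w k)) \<le> K * (1 + norm (y k)) * (1 + norm (w k))"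
      using F2 t by (rule F2D)
    also have "\<dots> \<le> K * (1 + norm (y k)) * (1 + M)"
      using w[OF k] \<open>K > 0\<close> by (intro mult_left_mono) auto
    finally have "h * norm (f (t k) (y k) (w k)) \<le> h * (K * (1 + norm (y k)) * (1 + M))"
      using \<open>h \<ge> 0\<close> by (rule mult_left_mono)
    moreover have "norm (y (Suc k)) \<le> norm (y k) + h * norm (f (t k) (y k) (w k))"
      using step[OF k] norm_triangle_ineq[of "y k" "h *\<^sub>R f (t k) (y k) (w k)"] \<open>h \<ge> 0\<close> by simp
    ultimately have "1 + norm (y (Suc k)) \<le> (1 + a) * (1 + norm (y k))"
      by (simp add: a_def algebra_simps)
    also have "\<dots> \<le> exp a * (1 + norm (y k))"
      by (intro mult_right_mono exp_ge_add_one_self) auto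
    finally show "1 + norm (y (Suc k)) \<le> exp a * (1 + norm (y k) + 0)" by simp
  qed (use a \<open>k \<le> N\<close> in auto)
  also have "\<dots> \<le> exp (real N * a) * (1 + norm (y 0))"
    using a \<open>k \<le> N\<close> by (auto intro!: mult_mono mult_right_mono)
  finally show ?thesis by (simp add: a_def algebra_simps)
qed

lemma le_exp_mult:
  fixes x M :: real
  assumes "x \<ge> 0" "M \<ge> 0"
  shows "M \<le> exp x * (1 + M)"
proof -
  have "1 * (1 + M) \<le> exp x * (1 + M)"
    using assms by (intro mult_right_mono) auto
  then show ?thesis by simp
qed

text \<open>Treating the constant history as a row before row 0 merges both step clauses of
  \<open>euler\<close> into the single recursion \<open>euler_Suc\<close>.\<close>

definition delayed :: "('d::finite) rhs \<Rightarrow> real \<Rightarrow> real ^ 'd \<Rightarrow> nat \<Rightarrow> nat \<Rightarrow> nat \<Rightarrow> real ^ 'd" where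
  "delayed f \<tau> \<eta> N j k = (case j of 0 \<Rightarrow> \<eta> | Suc i \<Rightarrow> euler f \<tau> \<eta> N i k)"

lemma euler_Suc:
  "euler f \<tau> \<eta> N j (Suc k) = euler f \<tau> \<eta> N j k
    + (\<tau> / real N) *\<^sub>R f (grid \<tau> N j k) (euler f \<tau> \<eta> N j k) (delayed f \<tau> \<eta> N j k)"
  by (cases j) (auto simp: delayed_def)

text \<open>Discrete method of steps. Since \<open>N\<close> steps of size
  \<open>\<tau> / real N\<close> add up to \<open>\<tau>\<close>, the bound can be chosen before
  \<open>N\<close> as well as before \<open>f\<close>.\<close>

lemma euler_bounded:
  fixes \<eta> :: "real ^ 'd"
  assumes "K > 0" "\<tau> > 0"
  shows "\<exists>M\<ge>0. \<forall>(f :: 'd rhs) N. F2 K f \<and> N > 0 \<longrightarrow>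
    (\<forall>i\<le>j. \<forall>k\<le>N. norm (euler f \<tau> \<eta> N i k) \<le> M \<and> norm (delayed f \<tau> \<eta> N i k) \<le> M)"
proof (induction j)
  case 0
  define M where "M = exp (K * (1 + norm \<eta>) * \<tau>) * (1 + norm \<eta>)"
  have M: "norm \<eta> \<le> M"
    using assms unfolding M_def by (intro le_exp_mult) auto
  have "norm (euler f \<tau> \<eta> N 0 k) \<le> M" if "F2 K f" "N > 0" "k \<le> N" for f :: "'d rhs" and N k
    using euler_bound_step[of N "euler f \<tau> \<eta> N 0" "\<tau> / real N" f "grid \<tau> N 0"
        "delayed f \<tau> \<eta> N 0" K "norm \<eta>" k] that assms
    by (simp add: euler_Suc grid_nonneg M_def) (simp add: delayed_def)
  then show ?case
    using M by (intro exI[of _ M]) (auto simp: delayed_def intro: order_trans[OF norm_ge_zero])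
next
  case (Suc j)
  then obtain M where M: "M \<ge> 0"
    "\<And>(f :: 'd rhs) N i k. F2 K f \<Longrightarrow> N > 0 \<Longrightarrow> i \<le> j \<Longrightarrow> k \<le> N \<Longrightarrow> norm (euler f \<tau> \<eta> N i k) \<le> M"
    "\<And>(f :: 'd rhs) N i k. F2 K f \<Longrightarrow> N > 0 \<Longrightarrow> i \<le> j \<Longrightarrow> k \<le> N \<Longrightarrow> norm (delayed f \<tau> \<eta> N i k) \<le> M"
    by auto
  define M' where "M' = exp (K * (1 + M) * \<tau>) * (1 + M)"
  have MM': "M \<le> M'"
    using assms M(1) unfolding M'_def by (intro le_exp_mult) auto
  have new: "norm (euler f \<tau> \<eta> N (Suc j) k) \<le> M'" "norm (delayed f \<tau> \<eta> N (Suc j) k) \<le> M'"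
    if "F2 K f" "N > 0" "k \<le> N" for f :: "'d rhs" and N k
  proof -
    have d: "norm (delayed f \<tau> \<eta> N (Suc j) k) \<le> M" if "k \<le> N" for k
      using M(2)[of f N j k] \<open>F2 K f\<close> \<open>N > 0\<close> that by (simp add: delayed_def)
    then show "norm (delayed f \<tau> \<eta> N (Suc j) k) \<le> M'"
      using \<open>k \<le> N\<close> MM' order_trans by blast
    have "1 + norm (euler f \<tau> \<eta> N (Suc j) k)
      \<le> exp (K * (1 + M) * (real N * (\<tau> / real N))) * (1 + norm (euler f \<tau> \<eta> N (Suc j) 0))"
      by (rule euler_bound_step[where N = N and f = f and t = "grid \<tau> N (Suc j)" and w = "delayed f \<tau> \<eta> N (Suc j)"])
        (use that assms M(1) d in \<open>simp_all only: euler_Suc, simp_all add: grid_nonneg\<close>)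
    also have "\<dots> = exp (K * (1 + M) * \<tau>) * (1 + norm (euler f \<tau> \<eta> N j N))"
      using \<open>N > 0\<close> by simp
    also have "\<dots> \<le> M'"
      unfolding M'_def using M(2)[of f N j N] that by (intro mult_left_mono) auto
    finally show "norm (euler f \<tau> \<eta> N (Suc j) k) \<le> M'" by simp
  qed
  have "norm (euler f \<tau> \<eta> N i k) \<le> M' \<and> norm (delayed f \<tau> \<eta> N i k) \<le> M'"
    if "F2 K f" "N > 0" "i \<le> Suc j" "k \<le> N" for f :: "'d rhs" and N i k
  proof (cases "i = Suc j")
    case False
    then have "i \<le> j" using that by simp
    then show ?thesis
      using M(2)[of f N i k] M(3)[of f N i k] that MM' by (blast intro: order_trans)
  qed (use new that in auto)
  moreover have "M' \<ge> 0" using M(1) MM' by linarith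
  ultimately show ?case by blast
qed

section \<open>Error accumulated over one segment\<close>

text \<open>The step factors multiply to at most \<open>exp (A * \<tau>)\<close>, and the
  contributions \<open>R\<^sup>2 * h\<close> add up to at most \<open>R\<^sup>2 * \<tau>\<close>, so
  the final square root gives back the order of \<open>R\<close>. \<open>S\<close> is the target
  rate; \<open>D\<close> and \<open>D'\<close> measure the initial error and the delayed error
  relative to it, so that the result is again a constant times \<open>S\<close>.\<close>

lemma segment_error:
  assumes F2: "F2 K f" and "K > 0" and F3: "F3 H f" and F4: "F4 L \<alpha> \<beta>1 \<beta>2 \<gamma> f" and "L > 0"
    and exps: "\<alpha> \<in> {0<..1}" "\<beta>1 \<in> {0<..1}" "\<beta>2 \<in> {0<..1}" "\<gamma> \<in> {0<..1}"
    and sol: "dde_solution f \<tau> \<eta> n z" and "\<tau> > 0" and "j \<le> n"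
    and N: "N > 0" "h = \<tau> / real N" "h \<le> 1"
    and z: "\<And>t. t \<in> {-\<tau>..(real n + 1) * \<tau>} \<Longrightarrow> norm (z t) \<le> M"
    and y: "\<And>k. k \<le> N \<Longrightarrow> norm (euler f \<tau> \<eta> N j k) \<le> M"
    and w: "\<And>k. k \<le> N \<Longrightarrow> norm (delayed f \<tau> \<eta> N j k) \<le> M"
    and vw: "\<And>k t. k < N \<Longrightarrow> t \<in> {grid \<tau> N j k..grid \<tau> N j k + h} \<Longrightarrow>
      norm (z (t - \<tau>) - delayed f \<tau> \<eta> N j k) \<le> \<delta>"
    and init: "norm (z (grid \<tau> N j 0) - euler f \<tau> \<eta> N j 0) \<le> D * S"
    and hS: "h powr \<alpha> + h powr \<beta>1 + h powr \<beta>2 \<le> S"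
    and \<delta>S: "\<delta> powr \<gamma> \<le> D' * S"
    and "k \<le> N"
  defines "A \<equiv> 2 * \<bar>H\<bar> * (1 + M) + 1"
    and "c \<equiv> L * (1 + 2 * M + K * (1 + M)\<^sup>2)\<^sup>2 * (1 + D')"
  shows "norm (z (grid \<tau> N j k) - euler f \<tau> \<eta> N j k) \<le> sqrt (exp (A * \<tau>) * (D\<^sup>2 + c\<^sup>2 * \<tau>)) * S"
proof -
  define R where
    "R = L * (1 + 2 * M + K * (1 + M)\<^sup>2)\<^sup>2 * (h powr \<alpha> + h powr \<beta>1 + h powr \<beta>2 + \<delta> powr \<gamma>)"
  let ?e = "\<lambda>k. (norm (z (grid \<tau> N j k) - euler f \<tau> \<eta> N j k))\<^sup>2"
  have M: "M \<ge> 0" using y[of 0] norm_ge_zero order_trans by blast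
  have A: "A \<ge> 0" using M by (simp add: A_def)
  have h: "h > 0" using N \<open>\<tau> > 0\<close> by simp
  have S: "S \<ge> 0" using order_trans[OF _ hS, of 0] by (simp add: add_nonneg_nonneg)
  have "R \<le> L * (1 + 2 * M + K * (1 + M)\<^sup>2)\<^sup>2 * (S + D' * S)"
    unfolding R_def using hS \<delta>S \<open>L > 0\<close> by (intro mult_left_mono add_mono) auto
  also have "\<dots> = c * S"
    by (simp add: c_def algebra_simps)
  finally have Rc: "R \<le> c * S" .
  have R0: "R \<ge> 0"
    unfolding R_def using \<open>L > 0\<close> by (intro mult_nonneg_nonneg add_nonneg_nonneg) auto
  have "?e k \<le> exp (real k * (A * h)) * (?e 0 + real k * (R\<^sup>2 * h))"
  proof (rule discrete_gronwall_exp[where N = N])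
    fix k assume k: "k < N"
    let ?a = "grid \<tau> N j k"
    have "?a \<ge> 0" using \<open>\<tau> > 0\<close> by (rule grid_nonneg)
    have "grid \<tau> N j (Suc k) \<in> {0..(real n + 1) * \<tau>}"
      by (rule subsetD[OF segment_mono grid_mem_segment]) (use k N \<open>\<tau> > 0\<close> \<open>j \<le> n\<close> in auto)
    then have I: "{?a..?a + h} \<subseteq> {0..(real n + 1) * \<tau>}"
      using \<open>?a \<ge> 0\<close> N by (simp add: grid_Suc)
    have "(norm (z (?a + h) - (euler f \<tau> \<eta> N j k + h *\<^sub>R f ?a (euler f \<tau> \<eta> N j k) (delayed f \<tau> \<eta> N j k))))\<^sup>2
       \<le> exp (A * h) * ((norm (z ?a - euler f \<tau> \<eta> N j k))\<^sup>2 + R\<^sup>2 * h)"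
      unfolding A_def R_def
    proof (rule euler_step_error[OF F2 \<open>K > 0\<close> F3 F4 \<open>L > 0\<close> exps _ \<open>h \<le> 1\<close> \<open>?a \<ge> 0\<close>])
      fix t assume t: "t \<in> {?a..?a + h}"
      show "(z has_vector_derivative f t (z t) (z (t - \<tau>))) (at t within {?a..?a + h})"
        using sol I t by (rule dde_solution_derivative)
      show "norm (z (t - \<tau>)) \<le> M"
        using t I \<open>\<tau> > 0\<close> by (intro z) auto
      show "norm (z (t - \<tau>) - delayed f \<tau> \<eta> N j k) \<le> \<delta>"
        using vw k t by blast
    qed (use h y w k in auto)
    then show "?e (Suc k) \<le> exp (A * h) * (?e k + R\<^sup>2 * h)"
      using N by (simp add: grid_Suc euler_Suc)
  qed (use A h \<open>k \<le> N\<close> in auto)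
  also have "\<dots> \<le> exp (A * \<tau>) * ((D * S)\<^sup>2 + (c * S)\<^sup>2 * \<tau>)"
  proof -
    have "real k * h \<le> real N * h"
      using \<open>k \<le> N\<close> h by (intro mult_right_mono) auto
    then have kh: "real k * h \<le> \<tau>"
      using N by simp
    have "real k * (A * h) \<le> A * \<tau>"
      using mult_left_mono[OF kh A] by (simp add: mult_ac)
    moreover have "R\<^sup>2 * (real k * h) \<le> (c * S)\<^sup>2 * \<tau>"
      using kh Rc R0 h by (intro mult_mono power_mono) auto
    then have "real k * (R\<^sup>2 * h) \<le> (c * S)\<^sup>2 * \<tau>"
      by (simp add: mult_ac)
    moreover have "?e 0 \<le> (D * S)\<^sup>2"
      using init by (intro power_mono) auto
    ultimately show ?thesis
      using h by (intro mult_mono[OF _ add_mono]) auto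
  qed
  also have "\<dots> = (exp (A * \<tau>) * (D\<^sup>2 + c\<^sup>2 * \<tau>)) * S\<^sup>2"
    by (simp add: power_mult_distrib algebra_simps)
  finally have "norm (z (grid \<tau> N j k) - euler f \<tau> \<eta> N j k) \<le> sqrt ((exp (A * \<tau>) * (D\<^sup>2 + c\<^sup>2 * \<tau>)) * S\<^sup>2)"
    by (rule real_le_rsqrt)
  then show ?thesis
    using S by (simp add: real_sqrt_mult)
qed

text \<open>Mean value inequality, with the derivative bounded by (F2) on the ball. It controls how
  far a delayed value moves away from its grid value within one step.\<close>

lemma solution_lipschitz:
  assumes sol: "dde_solution f \<tau> \<eta> n z" and F2: "F2 K f" and "K > 0" and "\<tau> > 0"
    and z: "\<And>t. t \<in> {-\<tau>..(real n + 1) * \<tau>} \<Longrightarrow> norm (z t) \<le> M"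
    and st: "s \<in> {0..(real n + 1) * \<tau>}" "t \<in> {0..(real n + 1) * \<tau>}"
  shows "norm (z t - z s) \<le> K * (1 + M)\<^sup>2 * \<bar>t - s\<bar>"
proof -
  let ?I = "{0..(real n + 1) * \<tau>}"
  have "norm (z t - z s) \<le> K * (1 + M)\<^sup>2 * norm (t - s)"
  proof (rule differentiable_bound)
    show "convex ?I" by simp
    fix r assume r: "r \<in> ?I"
    show "(z has_derivative (\<lambda>x. x *\<^sub>R f r (z r) (z (r - \<tau>)))) (at r within ?I)"
      using dde_solution_derivative[OF sol subset_refl r] by (simp add: has_vector_derivative_def)
    have "norm (f r (z r) (z (r - \<tau>))) \<le> K * (1 + M)\<^sup>2"
      using r \<open>\<tau> > 0\<close> by (intro F2_bounded[OF F2 \<open>K > 0\<close>] z) simp_all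
    then show "onorm (\<lambda>x. x *\<^sub>R f r (z r) (z (r - \<tau>))) \<le> K * (1 + M)\<^sup>2"
      by (intro onorm_le) (simp add: mult.commute[of "K * _"] mult_left_mono)
  qed (use st in auto)
  then show ?thesis by simp
qed

section \<open>Convergence rates and their behaviour from one segment to the next\<close>

definition rate :: "real \<Rightarrow> real \<Rightarrow> real \<Rightarrow> real \<Rightarrow> nat \<Rightarrow> real \<Rightarrow> real" where
  "rate \<alpha> \<beta>1 \<beta>2 \<gamma> j h =
     h powr (\<gamma> ^ j * min \<alpha> \<gamma>) + h powr (\<beta>1 * \<gamma> ^ j) + h powr (\<beta>2 * \<gamma> ^ j)"

lemma rate_nonneg: "rate \<alpha> \<beta>1 \<beta>2 \<gamma> j h \<ge> 0"
  by (simp add: rate_def add_nonneg_nonneg)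

lemma powr_mult_power_Suc_mono:
  fixes h p g :: real
  assumes "0 \<le> h" "h \<le> 1" "p \<ge> 0" "g \<in> {0<..1}"
  shows "h powr (p * g ^ j) \<le> h powr (p * g ^ Suc j)"
proof (rule powr_mono')
  have "g ^ Suc j \<le> g ^ j"
    using assms by (intro power_decreasing) auto
  then show "p * g ^ Suc j \<le> p * g ^ j"
    using assms(3) by (rule mult_left_mono)
qed (use assms in auto)

text \<open>Passing to the next segment shrinks the exponents, and \<open>h \<le> 1\<close>. Hence
  the error inherited at the start of a segment is absorbed by the rate of that segment.\<close>

lemma rate_Suc_mono:
  assumes "0 \<le> h" "h \<le> 1" "\<alpha> \<in> {0<..1}" "\<beta>1 \<in> {0<..1}" "\<beta>2 \<in> {0<..1}" "\<gamma> \<in> {0<..1}"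
  shows "rate \<alpha> \<beta>1 \<beta>2 \<gamma> j h \<le> rate \<alpha> \<beta>1 \<beta>2 \<gamma> (Suc j) h"
  unfolding rate_def mult.commute[of _ "min \<alpha> \<gamma>"]
  by (intro add_mono powr_mult_power_Suc_mono assms(1,2,6)) (use assms(3-6) in simp_all)

lemma rate_0_le:
  assumes "0 \<le> h" "h \<le> 1" "\<alpha> \<in> {0<..1}" "\<beta>1 \<in> {0<..1}" "\<beta>2 \<in> {0<..1}" "\<gamma> \<in> {0<..1}"
  shows "rate \<alpha> \<beta>1 \<beta>2 \<gamma> 0 h \<le> rate \<alpha> \<beta>1 \<beta>2 \<gamma> j h"
  by (induction j) (auto intro: order_trans rate_Suc_mono[OF assms])

text \<open>Subadditivity distributes the power \<open>\<gamma>\<close> over the three summands,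
  where it multiplies each exponent by \<open>\<gamma>\<close>. This is how the delayed error enters
  the next segment.\<close>

lemma rate_powr_le:
  assumes "0 \<le> h" "\<gamma> \<in> {0<..1}"
  shows "rate \<alpha> \<beta>1 \<beta>2 \<gamma> j h powr \<gamma> \<le> rate \<alpha> \<beta>1 \<beta>2 \<gamma> (Suc j) h"
proof -
  have "rate \<alpha> \<beta>1 \<beta>2 \<gamma> j h powr \<gamma>
    \<le> (h powr (\<gamma> ^ j * min \<alpha> \<gamma>) + h powr (\<beta>1 * \<gamma> ^ j)) powr \<gamma> + (h powr (\<beta>2 * \<gamma> ^ j)) powr \<gamma>"
    unfolding rate_def using assms by (intro powr_add_le) auto
  also have "\<dots> \<le> (h powr (\<gamma> ^ j * min \<alpha> \<gamma>)) powr \<gamma> + (h powr (\<beta>1 * \<gamma> ^ j)) powr \<gamma> + (h powr (\<beta>2 * \<gamma> ^ j)) powr \<gamma>"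
    using assms by (intro add_mono powr_add_le) auto
  also have "\<dots> = rate \<alpha> \<beta>1 \<beta>2 \<gamma> (Suc j) h"
    by (simp add: rate_def powr_powr mult_ac)
  finally show ?thesis .
qed

lemma powr_sum_le_rate_0:
  assumes "0 \<le> h" "h \<le> 1"
  shows "h powr \<alpha> + h powr \<beta>1 + h powr \<beta>2 \<le> rate \<alpha> \<beta>1 \<beta>2 \<gamma> 0 h"
  using assms by (auto simp: rate_def intro!: powr_mono')

text \<open>The movement of the delayed argument within a step costs order
  \<open>h powr \<gamma>\<close>; the minimum in the first exponent of \<open>rate\<close> covers
  it.\<close>

lemma powr_le_rate_0:
  assumes "0 \<le> h" "h \<le> 1"
  shows "h powr \<gamma> \<le> rate \<alpha> \<beta>1 \<beta>2 \<gamma> 0 h"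
proof -
  have "h powr \<gamma> \<le> h powr (min \<alpha> \<gamma>)"
    using assms by (intro powr_mono') auto
  then show ?thesis by (simp add: rate_def add_increasing2)
qed

section \<open>Induction over the segments and the final bounds\<close>

theorem theorem4p2:
  fixes \<tau> K H L \<alpha> \<beta>1 \<beta>2 \<gamma> :: real and \<eta> :: "real ^ 'd" and n :: nat
  assumes "\<tau> > 0" and "K > 0" and "L > 0"
    and "\<alpha> \<in> {0<..1}" and "\<beta>1 \<in> {0<..1}" and "\<beta>2 \<in> {0<..1}" and "\<gamma> \<in> {0<..1}"
  shows "\<exists>C :: nat \<Rightarrow> real. (\<forall>j\<le>n. C j \<ge> 0) \<and>
    (\<forall>(f :: 'd rhs) z (N :: nat) h.
       F1 f \<and> F2 K f \<and> F3 H f \<and> F4 L \<alpha> \<beta>1 \<beta>2 \<gamma> f \<and> dde_solution f \<tau> \<eta> n z \<and>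
       N > 0 \<and> int N \<ge> 2 * \<lceil>\<tau>\<rceil> \<and> h = \<tau> / real N \<longrightarrow>
         max_error f \<tau> \<eta> z N 0 \<le> C 0 * (h powr (min \<alpha> \<gamma>) + h powr \<beta>1 + h powr \<beta>2) \<and>
         (\<forall>j\<in>{1..n}. max_error f \<tau> \<eta> z N j \<le> C j * (\<Sum>l=1..j.
              h powr (1/2 * \<gamma> ^ (l - 1)) + h powr (\<gamma> ^ l * min \<alpha> \<gamma>)
              + h powr (\<beta>1 * \<gamma> ^ l) + h powr (\<beta>2 * \<gamma> ^ l))) \<and>
         (\<gamma> = 1 \<longrightarrow> (\<forall>j\<in>{1..n}. max_error f \<tau> \<eta> z N j
              \<le> real j * C j * (h powr (1/2) + h powr \<alpha> + h powr \<beta>1 + h powr \<beta>2))))"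
proof -
  let ?rate = "rate \<alpha> \<beta>1 \<beta>2 \<gamma>"
  let ?term = "\<lambda>l h. h powr (1/2 * \<gamma> ^ (l - 1)) + h powr (\<gamma> ^ l * min \<alpha> \<gamma>)
    + h powr (\<beta>1 * \<gamma> ^ l) + h powr (\<beta>2 * \<gamma> ^ l)"
  note exps = assms(4-7)
  obtain M1 where "M1 \<ge> 0" and M1: "\<And>(f :: 'd rhs) z t. F2 K f \<Longrightarrow> dde_solution f \<tau> \<eta> n z \<Longrightarrow>
      t \<in> {-\<tau>..(real n + 1) * \<tau>} \<Longrightarrow> norm (z t) \<le> M1"
    using solution_bounded[OF \<open>K > 0\<close> \<open>\<tau> > 0\<close>, of "Suc n" n \<eta>] by (auto simp: add.commute)
  obtain M2 where "M2 \<ge> 0" and M2: "\<And>(f :: 'd rhs) N i k. F2 K f \<Longrightarrow> N > 0 \<Longrightarrow> i \<le> n \<Longrightarrow> k \<le> N \<Longrightarrow>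
      norm (euler f \<tau> \<eta> N i k) \<le> M2 \<and> norm (delayed f \<tau> \<eta> N i k) \<le> M2"
    using euler_bounded[OF \<open>K > 0\<close> \<open>\<tau> > 0\<close>, of n \<eta>] by auto
  define M where "M = max M1 M2"
  have z: "norm (z t) \<le> M" if "F2 K f" "dde_solution f \<tau> \<eta> n z" "t \<in> {-\<tau>..(real n + 1) * \<tau>}"
    for f :: "'d rhs" and z t
    using M1[OF that] by (simp add: M_def)
  have y: "norm (euler f \<tau> \<eta> N i k) \<le> M" and w: "norm (delayed f \<tau> \<eta> N i k) \<le> M"
    if "F2 K f" "N > 0" "i \<le> n" "k \<le> N" for f :: "'d rhs" and N i k
    using M2[OF that] by (auto simp: M_def)
  define Q where "Q = K * (1 + M)\<^sup>2"
  have Q: "Q \<ge> 0" using \<open>K > 0\<close> by (simp add: Q_def)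
  define A where "A = 2 * \<bar>H\<bar> * (1 + M) + 1"
  define c where "c D' = L * (1 + 2 * M + Q)\<^sup>2 * (1 + D')" for D'
  \<comment> \<open>This is the factor produced by \<open>segment_error\<close>; folding the
    abbreviations into \<open>seg\<close> below makes its conclusion read
    \<open>const D D' * S\<close>.\<close>
  define const where "const D D' = sqrt (exp (A * \<tau>) * (D\<^sup>2 + (c D')\<^sup>2 * \<tau>))" for D D'
  have const: "const D D' \<ge> 0" for D D'
    using \<open>\<tau> > 0\<close> by (simp add: const_def)
  note powr_sum_le = order_trans[OF powr_sum_le_rate_0 rate_0_le[OF _ _ exps]]
  note seg = segment_error[OF _ \<open>K > 0\<close> _ _ \<open>L > 0\<close> exps _ \<open>\<tau> > 0\<close>, where M = M and H = H,
      folded Q_def A_def, folded c_def, folded const_def]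
  \<comment> \<open>\<open>D\<close> is quantified before \<open>f\<close>, \<open>z\<close> and
    \<open>N\<close>, so the induction carries the uniformity of the constants along with the
    rate.\<close>
  have "\<exists>D\<ge>0. \<forall>(f :: 'd rhs) z N.
    F2 K f \<and> F3 H f \<and> F4 L \<alpha> \<beta>1 \<beta>2 \<gamma> f \<and> dde_solution f \<tau> \<eta> n z \<and> N > 0 \<and> \<tau> / real N \<le> 1 \<longrightarrow>
    (\<forall>k\<le>N. norm (z (grid \<tau> N j k) - euler f \<tau> \<eta> N j k) \<le> D * ?rate j (\<tau> / real N))"
    if "j \<le> n" for j
    using that
  proof (induction j)
    case 0
    have "norm (z (grid \<tau> N 0 k) - euler f \<tau> \<eta> N 0 k) \<le> const 0 0 * ?rate 0 (\<tau> / real N)"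
      if f: "F2 K f" "F3 H f" "F4 L \<alpha> \<beta>1 \<beta>2 \<gamma> f" and sol: "dde_solution f \<tau> \<eta> n z"
        and N: "N > 0" "\<tau> / real N \<le> 1" and k: "k \<le> N" for f :: "'d rhs" and z N k
    \<comment> \<open>On the first segment the delayed argument is exactly \<open>\<eta>\<close> and
      the scheme starts at the exact value. Both relative errors are 0, using
      \<open>0 powr \<gamma> = 0\<close>.\<close>
    proof (rule seg[OF f sol _ N(1) refl N(2), where \<delta> = 0])
      fix k t assume k: "k < N" and t: "t \<in> {grid \<tau> N 0 k..grid \<tau> N 0 k + \<tau> / real N}"
      then have "t \<in> {0..\<tau>}"
        using grid_mem_segment[of \<tau> k N 0] grid_mem_segment[of \<tau> "Suc k" N 0] N \<open>\<tau> > 0\<close>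
        by (auto simp: grid_Suc)
      then show "norm (z (t - \<tau>) - delayed f \<tau> \<eta> N 0 k) \<le> 0"
        using dde_solution_history[OF sol, of "t - \<tau>"] by (simp add: delayed_def)
    next
      show "norm (z (grid \<tau> N 0 0) - euler f \<tau> \<eta> N 0 0) \<le> 0 * ?rate 0 (\<tau> / real N)"
        using dde_solution_history[OF sol, of 0] \<open>\<tau> > 0\<close> by (simp add: grid_def)
    qed (use N k \<open>\<tau> > 0\<close> in \<open>simp_all add: z[OF f(1) sol] y[OF f(1)] w[OF f(1)] powr_sum_le_rate_0\<close>)
    then show ?case using const by blast
  next
    case (Suc j)
    then obtain D where "D \<ge> 0" and D: "\<And>(f :: 'd rhs) z N k.
        F2 K f \<Longrightarrow> F3 H f \<Longrightarrow> F4 L \<alpha> \<beta>1 \<beta>2 \<gamma> f \<Longrightarrow> dde_solution f \<tau> \<eta> n z \<Longrightarrow> N > 0 \<Longrightarrow>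
        \<tau> / real N \<le> 1 \<Longrightarrow> k \<le> N \<Longrightarrow>
        norm (z (grid \<tau> N j k) - euler f \<tau> \<eta> N j k) \<le> D * ?rate j (\<tau> / real N)"
      by auto
    \<comment> \<open>The first argument of \<open>const\<close> is \<open>D\<close>, as the segment
      starts with the error at the last node of the previous one. The second is
      \<open>(1 + Q) + (1 + D)\<close>, from the two parts of the delayed error raised to the power
      \<open>\<gamma>\<close>.\<close>
    have "norm (z (grid \<tau> N (Suc j) k) - euler f \<tau> \<eta> N (Suc j) k)
        \<le> const D (2 + Q + D) * ?rate (Suc j) (\<tau> / real N)"
      if f: "F2 K f" "F3 H f" "F4 L \<alpha> \<beta>1 \<beta>2 \<gamma> f" and sol: "dde_solution f \<tau> \<eta> n z"
        and N: "N > 0" "\<tau> / real N \<le> 1" and k: "k \<le> N" for f :: "'d rhs" and z N k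
    proof -
      define h where "h = \<tau> / real N"
      have h: "0 \<le> h" "h \<le> 1" using N \<open>\<tau> > 0\<close> by (auto simp: h_def)
      have e: "norm (z (grid \<tau> N j k) - euler f \<tau> \<eta> N j k) \<le> D * ?rate j h" if "k \<le> N" for k
        using D[OF f sol N that] by (simp add: h_def)
      have "norm (z (grid \<tau> N (Suc j) k) - euler f \<tau> \<eta> N (Suc j) k)
        \<le> const D (2 + Q + D) * ?rate (Suc j) h"
      proof (rule seg[OF f sol Suc.prems N(1) h_def h(2), where \<delta> = "Q * h + D * ?rate j h"])
        fix k t assume k: "k < N" and t: "t \<in> {grid \<tau> N (Suc j) k..grid \<tau> N (Suc j) k + h}"
        have I: "{real j * \<tau>..(real j + 1) * \<tau>} \<subseteq> {0..(real n + 1) * \<tau>}"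
          using \<open>\<tau> > 0\<close> Suc.prems by (intro segment_mono) auto
        have g: "grid \<tau> N j k \<in> {0..(real n + 1) * \<tau>}" "grid \<tau> N j k + h \<in> {0..(real n + 1) * \<tau>}"
          unfolding h_def grid_Suc[symmetric]
          by (rule subsetD[OF I grid_mem_segment]; use k N(1) \<open>\<tau> > 0\<close> in simp)+
        have t': "t - \<tau> \<in> {grid \<tau> N j k..grid \<tau> N j k + h}"
          using t grid_shift[of \<tau> N j k] by auto
        \<comment> \<open>The delayed error is split at the exact value in the grid point: Lipschitz
          movement of \<open>z\<close> on one side, error of the previous segment on the
          other.\<close>
        have "norm (z (t - \<tau>) - z (grid \<tau> N j k)) \<le> Q * \<bar>t - \<tau> - grid \<tau> N j k\<bar>"
          unfolding Q_def using g t'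
          by (intro solution_lipschitz[OF sol f(1) \<open>K > 0\<close> \<open>\<tau> > 0\<close> z[OF f(1) sol]]) simp_all
        also have "\<dots> \<le> Q * h"
          using t' Q by (intro mult_left_mono) auto
        finally show "norm (z (t - \<tau>) - delayed f \<tau> \<eta> N (Suc j) k) \<le> Q * h + D * ?rate j h"
          using e[of k] k unfolding delayed_def nat.case by (intro norm_diff_triangle_le) auto
      next
        have "D * ?rate j h \<le> D * ?rate (Suc j) h"
          using \<open>D \<ge> 0\<close> h exps by (intro mult_left_mono rate_Suc_mono)
        then show "norm (z (grid \<tau> N (Suc j) 0) - euler f \<tau> \<eta> N (Suc j) 0) \<le> D * ?rate (Suc j) h"
          using e[of N] N(1) by (simp add: grid_Suc_0)
      next
        show "h powr \<alpha> + h powr \<beta>1 + h powr \<beta>2 \<le> ?rate (Suc j) h"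
          using h by (intro powr_sum_le)
      next
        have "(Q * h + D * ?rate j h) powr \<gamma> \<le> (Q * h) powr \<gamma> + (D * ?rate j h) powr \<gamma>"
          using Q h(1) \<open>D \<ge> 0\<close> exps(4) by (intro powr_add_le mult_nonneg_nonneg rate_nonneg) simp_all
        also have "\<dots> \<le> (1 + Q) * h powr \<gamma> + (1 + D) * ?rate j h powr \<gamma>"
          using Q h(1) \<open>D \<ge> 0\<close> exps(4) by (intro add_mono powr_mult_le rate_nonneg) simp_all
        also have "\<dots> \<le> (1 + Q) * ?rate (Suc j) h + (1 + D) * ?rate (Suc j) h"
          using Q \<open>D \<ge> 0\<close>
          by (intro add_mono mult_left_mono rate_powr_le order_trans[OF powr_le_rate_0 rate_0_le] h exps) simp_all
        finally show "(Q * h + D * ?rate j h) powr \<gamma> \<le> (2 + Q + D) * ?rate (Suc j) h"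
          by (simp add: algebra_simps)
      qed (use N k Suc.prems in \<open>simp_all add: z[OF f(1) sol] y[OF f(1)] w[OF f(1)]\<close>)
      then show ?thesis by (simp add: h_def)
    qed
    then show ?case using const by blast
  qed
  then have "\<forall>j\<in>{..n}. \<exists>D\<ge>0. \<forall>(f :: 'd rhs) z N.
    F2 K f \<and> F3 H f \<and> F4 L \<alpha> \<beta>1 \<beta>2 \<gamma> f \<and> dde_solution f \<tau> \<eta> n z \<and> N > 0 \<and> \<tau> / real N \<le> 1 \<longrightarrow>
    (\<forall>k\<le>N. norm (z (grid \<tau> N j k) - euler f \<tau> \<eta> N j k) \<le> D * ?rate j (\<tau> / real N))"
    by simp
  then obtain C where C0: "\<And>j. j \<le> n \<Longrightarrow> C j \<ge> 0" and C: "\<And>j (f :: 'd rhs) z N k.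
    j \<le> n \<Longrightarrow> F2 K f \<Longrightarrow> F3 H f \<Longrightarrow> F4 L \<alpha> \<beta>1 \<beta>2 \<gamma> f \<Longrightarrow> dde_solution f \<tau> \<eta> n z \<Longrightarrow> N > 0 \<Longrightarrow>
    \<tau> / real N \<le> 1 \<Longrightarrow> k \<le> N \<Longrightarrow>
    norm (z (grid \<tau> N j k) - euler f \<tau> \<eta> N j k) \<le> C j * ?rate j (\<tau> / real N)"
    unfolding bchoice_iff by (metis atMost_iff)
  show ?thesis
  proof (intro exI[of _ C] conjI allI impI)
    fix j assume "j \<le> n" then show "C j \<ge> 0" by (rule C0)
  next
    fix f :: "'d rhs" and z N h
    assume *: "F1 f \<and> F2 K f \<and> F3 H f \<and> F4 L \<alpha> \<beta>1 \<beta>2 \<gamma> f \<and> dde_solution f \<tau> \<eta> n z \<and>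
       N > 0 \<and> int N \<ge> 2 * \<lceil>\<tau>\<rceil> \<and> h = \<tau> / real N"
    \<comment> \<open>Positivity of the ceiling lets the factor 2 be dropped; the result is
      \<open>h \<le> 1\<close>.\<close>
    have "\<tau> \<le> real N"
    proof -
      have "0 < \<lceil>\<tau>\<rceil>" using \<open>\<tau> > 0\<close> by simp
      then have "\<lceil>\<tau>\<rceil> \<le> int N" using * by linarith
      then show ?thesis by (simp add: ceiling_le_iff)
    qed
    then have h1: "\<tau> / real N \<le> 1" using * by simp
    have err: "max_error f \<tau> \<eta> z N j \<le> C j * ?rate j h" if "j \<le> n" for j
      unfolding max_error_def
    proof (rule Max.boundedI)
      fix x assume "x \<in> (\<lambda>k. norm (segment z \<tau> j (grid \<tau> N j k) - euler f \<tau> \<eta> N j k)) ` {0..N}"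
      then obtain k where k: "k \<le> N" and x: "x = norm (segment z \<tau> j (grid \<tau> N j k) - euler f \<tau> \<eta> N j k)"
        by auto
      \<comment> \<open>\<open>restrict\<close> returns \<open>undefined\<close> off the segment, so
        membership of the grid point has to be checked.\<close>
      have "segment z \<tau> j (grid \<tau> N j k) = z (grid \<tau> N j k)"
        using grid_mem_segment[OF \<open>\<tau> > 0\<close> k, of j] * by (simp add: segment_def)
      then show "x \<le> C j * ?rate j h"
        using C[OF that, of f z N k] * h1 k x by simp
    qed auto
    show "max_error f \<tau> \<eta> z N 0 \<le> C 0 * (h powr (min \<alpha> \<gamma>) + h powr \<beta>1 + h powr \<beta>2)"
      using err[of 0] by (simp add: rate_def)
    have main: "max_error f \<tau> \<eta> z N j \<le> C j * (\<Sum>l=1..j. ?term l h)" if j: "j \<in> {1..n}" for j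
    proof -
      \<comment> \<open>The rate is the last summand without its half-power term; all terms are
        nonnegative.\<close>
      have "?rate j h \<le> ?term j h" by (simp add: rate_def)
      also have "\<dots> \<le> (\<Sum>l=1..j. ?term l h)"
        using j by (intro member_le_sum) (auto intro: add_nonneg_nonneg)
      finally have "C j * ?rate j h \<le> C j * (\<Sum>l=1..j. ?term l h)"
        using j C0 by (intro mult_left_mono) auto
      then show ?thesis using err[of j] j by auto
    qed
    then show "\<forall>j\<in>{1..n}. max_error f \<tau> \<eta> z N j \<le> C j * (\<Sum>l=1..j. ?term l h)" by blast
    \<comment> \<open>For \<open>\<gamma> = 1\<close> the summands do not depend on
      \<open>l\<close>, whence the factor \<open>real j\<close>, and
      \<open>min \<alpha> 1 = \<alpha>\<close>.\<close>
    show "\<forall>j\<in>{1..n}. max_error f \<tau> \<eta> z N j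
        \<le> real j * C j * (h powr (1/2) + h powr \<alpha> + h powr \<beta>1 + h powr \<beta>2)" if "\<gamma> = 1"
      using main that assms(4) by (auto simp: mult_ac)
  qed
qed

end
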